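(* Let ${}_RM$ be a Laskerian le-module over a commutative ring $R$ with $1$. Let $n$ be a submodule element of $M$ which has a reduced primary decomposition $n = q_1 \wedge q_2 \wedge \cdots \wedge q_r$. Let $P$ be a prime ideal of $R$. Then $P = \mathrm{Rad}(q_i)$ for some $i \in \{1,\dots,r\}$ if and only if there exists $x \in M$ with $x \not\leqslant n$ such that $(n:x)$ is a $P$-primary ideal of $R$. Hence the set $\{\mathrm{Rad}(q_1),\dots,\mathrm{Rad}(q_r)\}$ of associated primes of $n$ is independent of the choice of reduced primary decomposition of $n$.
   Context: $R$ is a commutative ring with $1$. An le-semigroup $(M,+,\leqslant,e)$ is a commutative monoid with zero element $0_M$ that is at the same time a complete lattice with greatest element $e$, such that $m+\bigvee_{i\in I} m_i=\bigvee_{i\in I}(m+m_i)$ for all $m\in M$ and all families $(m_i)_{i\in I}$ in $M$. An le-module ${}_RM$ is an le-semigroup $M$ with a map $R\times M\to M$, $(r,m)\mapsto rm$, such that for all $r,r_1,r_2\in R$, $m,m_1,m_2\in M$ and families $(m_i)_{i\in I}$ in $M$: $r(m_1+m_2)=rm_1+rm_2$; $(r_1+r_2)m\leqslant r_1m+r_2m$; $(r_1r_2)m=r_1(r_2m)$; $1_Rm=m$; $0_Rm=r0_M=0_M$; $r(\bigvee_{i\in I} m_i)=\bigvee_{i\in I} rm_i$. A submodule element of $M$ is an $n\in M$ with $n+n\leqslant n$ and $rn\leqslant n$ for all $r\in R$; it is proper if $n\ne e$. For a submodule element $l$ and $x\in M$, $(l:x)=\{r\in R: rx\leqslant l\}$,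 an ideal of $R$. $\mathrm{Rad}(l)$ denotes the radical of the ideal $(l:e)$, i.e. $\{a\in R: a^m e\leqslant l \text{ for some integer } m\geq 1\}$. A proper submodule element $q$ is primary if for all $a\in R$, $x\in M$, $ax\leqslant q$ implies $x\leqslant q$ or $a^me\leqslant q$ for some integer $m\ge1$. A primary decomposition of a submodule element $n$ is an expression $n=q_1\wedge\cdots\wedge q_k$ ($k\ge 1$) with all $q_i$ primary. It is reduced if (i) $\bigwedge_{j\neq i}q_j\not\leqslant q_i$ for each $i$ (the empty meet being $e$), and (ii) $\mathrm{Rad}(q_i)\neq \mathrm{Rad}(q_j)$ for $i\ne j$. The le-module ${}_RM$ is Laskerian if every proper submodule element of $M$ has a primary decomposition. The associated primes of $n$ are the ideals $\mathrm{Rad}(q_i)$ for a reduced primary decomposition of $n$. An ideal of $R$ is $P$-primary if it is a primary ideal whose radical is $P$. *)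

theory Defs
  imports "HOL-Algebra.Complete_Lattice" "HOL-Algebra.Ideal"
begin

record 'm le_semigroup = "'m gorder" +
  le_add :: "['m, 'm] \<Rightarrow> 'm" (infixl \<open>\<boxplus>\<index>\<close> 65)
  le_zero :: 'm

definition le_semigroup_monoid :: "('m, 'z) le_semigroup_scheme \<Rightarrow> 'm monoid" where
  "le_semigroup_monoid M =
    \<lparr>carrier = carrier M, monoid.mult = le_add M, monoid.one = le_zero M\<rparr>"

text \<open>
  The families in the distributivity laws of le-semigroups and le-modules range over nonempty
  index sets, represented by their (nonempty) ranges \<open>A\<close>. Admitting the empty family would
  force the least element to be \<open>0\<close> (scalar law for \<open>r = 0\<close>) and then \<open>m = m + 0 = 0\<close> for
  every \<open>m\<close>. The greatest element \<open>e\<close> is \<open>\<top>\<^bsub>M\<^esub>\<close>.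
\<close>

locale le_semigroup = complete_lattice M for M (structure) +
  assumes add_comm_monoid: "comm_monoid (le_semigroup_monoid M)"
    and add_sup_distrib:
      "\<lbrakk>m \<in> carrier M; A \<subseteq> carrier M; A \<noteq> {}\<rbrakk>
        \<Longrightarrow> m \<boxplus> \<Squnion>A = \<Squnion>((\<lambda>a. m \<boxplus> a) ` A)"

record ('r, 'm) le_module = "'m le_semigroup" +
  le_smult :: "['r, 'm] \<Rightarrow> 'm" (infixr \<open>\<cdot>\<index>\<close> 70)

locale le_module = R?: cring R + M?: le_semigroup M for R (structure) and M (structure) +
  assumes smult_closed:
      "\<lbrakk>r \<in> carrier R; m \<in> carrier M\<rbrakk> \<Longrightarrow> r \<cdot>\<^bsub>M\<^esub> m \<in> carrier M"
    and smult_add: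
      "\<lbrakk>r \<in> carrier R; m1 \<in> carrier M; m2 \<in> carrier M\<rbrakk>
        \<Longrightarrow> r \<cdot>\<^bsub>M\<^esub> (m1 \<boxplus>\<^bsub>M\<^esub> m2) = (r \<cdot>\<^bsub>M\<^esub> m1) \<boxplus>\<^bsub>M\<^esub> (r \<cdot>\<^bsub>M\<^esub> m2)"
    and add_smult_le:
      "\<lbrakk>r1 \<in> carrier R; r2 \<in> carrier R; m \<in> carrier M\<rbrakk>
        \<Longrightarrow> (r1 \<oplus>\<^bsub>R\<^esub> r2) \<cdot>\<^bsub>M\<^esub> m \<sqsubseteq>\<^bsub>M\<^esub> (r1 \<cdot>\<^bsub>M\<^esub> m) \<boxplus>\<^bsub>M\<^esub> (r2 \<cdot>\<^bsub>M\<^esub> m)"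
    and mult_smult:
      "\<lbrakk>r1 \<in> carrier R; r2 \<in> carrier R; m \<in> carrier M\<rbrakk>
        \<Longrightarrow> (r1 \<otimes>\<^bsub>R\<^esub> r2) \<cdot>\<^bsub>M\<^esub> m = r1 \<cdot>\<^bsub>M\<^esub> (r2 \<cdot>\<^bsub>M\<^esub> m)"
    and one_smult: "m \<in> carrier M \<Longrightarrow> \<one>\<^bsub>R\<^esub> \<cdot>\<^bsub>M\<^esub> m = m"
    and zero_smult: "m \<in> carrier M \<Longrightarrow> \<zero>\<^bsub>R\<^esub> \<cdot>\<^bsub>M\<^esub> m = le_zero M"
    and smult_zero: "r \<in> carrier R \<Longrightarrow> r \<cdot>\<^bsub>M\<^esub> le_zero M = le_zero M"
    and smult_sup_distrib:
      "\<lbrakk>r \<in> carrier R; A \<subseteq> carrier M; A \<noteq> {}\<rbrakk>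
        \<Longrightarrow> r \<cdot>\<^bsub>M\<^esub> (\<Squnion>\<^bsub>M\<^esub>A) = \<Squnion>\<^bsub>M\<^esub>((\<lambda>a. r \<cdot>\<^bsub>M\<^esub> a) ` A)"

definition ideal_radical :: "('r, 'x) ring_scheme \<Rightarrow> 'r set \<Rightarrow> 'r set" where
  "ideal_radical R I = {a \<in> carrier R. \<exists>m::nat. m \<ge> 1 \<and> a [^]\<^bsub>R\<^esub> m \<in> I}"

definition primary_ideal :: "('r, 'x) ring_scheme \<Rightarrow> 'r set \<Rightarrow> bool" where
  "primary_ideal R Q \<longleftrightarrow> ideal Q R \<and> Q \<noteq> carrier R \<and>
    (\<forall>a \<in> carrier R. \<forall>b \<in> carrier R. a \<otimes>\<^bsub>R\<^esub> b \<in> Q \<longrightarrow>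
      a \<in> Q \<or> (\<exists>m::nat. m \<ge> 1 \<and> b [^]\<^bsub>R\<^esub> m \<in> Q))"

definition primary_ideal_to :: "('r, 'x) ring_scheme \<Rightarrow> 'r set \<Rightarrow> 'r set \<Rightarrow> bool" where
  "primary_ideal_to R P Q \<longleftrightarrow> primary_ideal R Q \<and> ideal_radical R Q = P"

definition submodule_element ::
    "('r, 'x) ring_scheme \<Rightarrow> ('r, 'm, 'z) le_module_scheme \<Rightarrow> 'm \<Rightarrow> bool" where
  "submodule_element R M n \<longleftrightarrow>
    n \<in> carrier M \<and> n \<boxplus>\<^bsub>M\<^esub> n \<sqsubseteq>\<^bsub>M\<^esub> n \<and> (\<forall>r \<in> carrier R. r \<cdot>\<^bsub>M\<^esub> n \<sqsubseteq>\<^bsub>M\<^esub> n)"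

definition proper_submodule_element ::
    "('r, 'x) ring_scheme \<Rightarrow> ('r, 'm, 'z) le_module_scheme \<Rightarrow> 'm \<Rightarrow> bool" where
  "proper_submodule_element R M n \<longleftrightarrow> submodule_element R M n \<and> n \<noteq> \<top>\<^bsub>M\<^esub>"

definition colon ::
    "('r, 'x) ring_scheme \<Rightarrow> ('r, 'm, 'z) le_module_scheme \<Rightarrow> 'm \<Rightarrow> 'm \<Rightarrow> 'r set" where
  "colon R M l x = {r \<in> carrier R. r \<cdot>\<^bsub>M\<^esub> x \<sqsubseteq>\<^bsub>M\<^esub> l}"

definition Rad ::
    "('r, 'x) ring_scheme \<Rightarrow> ('r, 'm, 'z) le_module_scheme \<Rightarrow> 'm \<Rightarrow> 'r set" where
  "Rad R M l = ideal_radical R (colon R M l \<top>\<^bsub>M\<^esub>)"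

definition primary_element ::
    "('r, 'x) ring_scheme \<Rightarrow> ('r, 'm, 'z) le_module_scheme \<Rightarrow> 'm \<Rightarrow> bool" where
  "primary_element R M q \<longleftrightarrow> proper_submodule_element R M q \<and>
    (\<forall>a \<in> carrier R. \<forall>x \<in> carrier M. a \<cdot>\<^bsub>M\<^esub> x \<sqsubseteq>\<^bsub>M\<^esub> q \<longrightarrow>
      x \<sqsubseteq>\<^bsub>M\<^esub> q \<or> (\<exists>m::nat. m \<ge> 1 \<and> (a [^]\<^bsub>R\<^esub> m) \<cdot>\<^bsub>M\<^esub> \<top>\<^bsub>M\<^esub> \<sqsubseteq>\<^bsub>M\<^esub> q))"

text \<open>
  A decomposition \<open>n = q\<^sub>1 \<and> \<dots> \<and> q\<^sub>k\<close> is given by \<open>k\<close> and a function \<open>q\<close> of which only the values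
  on \<open>{1..k}\<close> matter.
\<close>

definition primary_decomposition ::
    "('r, 'x) ring_scheme \<Rightarrow> ('r, 'm, 'z) le_module_scheme \<Rightarrow> 'm \<Rightarrow> nat \<Rightarrow> (nat \<Rightarrow> 'm) \<Rightarrow> bool"
  where
  "primary_decomposition R M n k q \<longleftrightarrow>
    k \<ge> 1 \<and> (\<forall>i \<in> {1..k}. primary_element R M (q i)) \<and> n = \<Sqinter>\<^bsub>M\<^esub>(q ` {1..k})"

text \<open>For \<open>k = 1\<close> the meet in the first condition is \<open>\<Sqinter>\<^bsub>M\<^esub>{}\<close>, which equals \<open>\<top>\<^bsub>M\<^esub>\<close>.\<close>

definition reduced_primary_decomposition ::
    "('r, 'x) ring_scheme \<Rightarrow> ('r, 'm, 'z) le_module_scheme \<Rightarrow> 'm \<Rightarrow> nat \<Rightarrow> (nat \<Rightarrow> 'm) \<Rightarrow> bool"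
  where
  "reduced_primary_decomposition R M n k q \<longleftrightarrow> primary_decomposition R M n k q \<and>
    (\<forall>i \<in> {1..k}. \<not> \<Sqinter>\<^bsub>M\<^esub>(q ` ({1..k} - {i})) \<sqsubseteq>\<^bsub>M\<^esub> q i) \<and>
    (\<forall>i \<in> {1..k}. \<forall>j \<in> {1..k}. i \<noteq> j \<longrightarrow> Rad R M (q i) \<noteq> Rad R M (q j))"

definition laskerian ::
    "('r, 'x) ring_scheme \<Rightarrow> ('r, 'm, 'z) le_module_scheme \<Rightarrow> bool" where
  "laskerian R M \<longleftrightarrow>
    (\<forall>n. proper_submodule_element R M n \<longrightarrow> (\<exists>k q. primary_decomposition R M n k q))"

lemma (in le_module) Inf_empty_eq_top: "\<Sqinter>\<^bsub>M\<^esub>{} = \<top>\<^bsub>M\<^esub>"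
  by (simp add: inf_def top_def Lower_def greatest_def)

end

theory Submission
  imports Defs
begin

text \<open>
  For a primary element \<open>q\<close> and \<open>x\<close> not below \<open>q\<close>, the ideal \<open>(q : x)\<close> is primary with
  radical \<open>Rad q\<close>, and \<open>(n : x)\<close> is the intersection of the \<open>(q\<^sub>j : x)\<close>. Choosing \<open>x\<close> as the meet of
  all \<open>q\<^sub>j\<close> with \<open>j \<noteq> i\<close> collapses this intersection to \<open>(q\<^sub>i : x)\<close>, so \<open>Rad q\<^sub>i\<close> occurs. Conversely, a
  prime that is the radical of \<open>(n : x)\<close> contains, hence is the radical of, one of the \<open>(q\<^sub>j : x)\<close>.
  Uniqueness follows since the characterisation only mentions \<open>n\<close> and each \<open>Rad q\<^sub>i\<close> is prime.
\<close>

section \<open>Radicals, primary ideals and prime ideals of a commutative ring\<close>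

text \<open>The factor \<open>c\<close> makes the induction on \<open>m + l\<close> work without the binomial theorem.\<close>

lemma (in cring) add_pow_mult_mem_ideal:
  fixes m l :: nat
  assumes I: "ideal I R" and ab: "a \<in> carrier R" "b \<in> carrier R"
    and c: "c \<in> carrier R" and "a [^] m \<otimes> c \<in> I" "b [^] l \<otimes> c \<in> I"
  shows "(a \<oplus> b) [^] (m + l) \<otimes> c \<in> I"
  using c assms(5,6)
proof (induction "m + l" arbitrary: m l c)
  case 0
  then show ?case by simp
next
  case (Suc N)
  note c = \<open>c \<in> carrier R\<close>
  interpret I: ideal I R by (rule I)
  have s: "(a \<oplus> b) [^] (k::nat) \<in> carrier R" for k using ab by simp
  show ?case
  \<comment> \<open>If one exponent is zero, the corresponding hypothesis says that \<open>c\<close>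
    itself lies in \<open>I\<close>. Otherwise one factor \<open>a \<oplus> b\<close> is split off.
    In the summand with \<open>a\<close>, this \<open>a\<close> is absorbed into \<open>c\<close>,
    which lowers the exponent needed for \<open>a\<close> by one and keeps the one for
    \<open>b\<close>; the summand with \<open>b\<close> is symmetric. Both then carry the power
    \<open>N\<close> of \<open>a \<oplus> b\<close>.\<close>
  proof (cases "m = 0 \<or> l = 0")
    case True
    then have "c \<in> I" using Suc.prems by auto
    then show ?thesis using I.I_l_closed s by blast
  next
    case False
    then obtain m' l' where ml: "m = Suc m'" "l = Suc l'" by (meson not0_implies_Suc)
    have "(a \<oplus> b) [^] (m' + l) \<otimes> (a \<otimes> c) \<in> I"
    proof (rule Suc.hyps(1))
      show "a [^] m' \<otimes> (a \<otimes> c) \<in> I" using Suc.prems ab by (simp add: ml m_assoc)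
      have "a \<otimes> (b [^] l \<otimes> c) \<in> I" using Suc.prems ab I.I_l_closed by blast
      then show "b [^] l \<otimes> (a \<otimes> c) \<in> I" using ab c by (simp add: m_lcomm)
    qed (use Suc ml ab in auto)
    moreover have "(a \<oplus> b) [^] (m + l') \<otimes> (b \<otimes> c) \<in> I"
    proof (rule Suc.hyps(1))
      show "b [^] l' \<otimes> (b \<otimes> c) \<in> I" using Suc.prems ab by (simp add: ml m_assoc)
      have "b \<otimes> (a [^] m \<otimes> c) \<in> I" using Suc.prems ab I.I_l_closed by blast
      then show "a [^] m \<otimes> (b \<otimes> c) \<in> I" using ab c by (simp add: m_lcomm)
    qed (use Suc ml ab in auto)
    ultimately have "(a \<oplus> b) [^] N \<otimes> (a \<otimes> c) \<oplus> (a \<oplus> b) [^] N \<otimes> (b \<otimes> c) \<in> I"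
      using Suc.hyps(2) ml by (metis I.a_closed add_Suc add_Suc_right nat.inject)
    also have "(a \<oplus> b) [^] N \<otimes> (a \<otimes> c) \<oplus> (a \<oplus> b) [^] N \<otimes> (b \<otimes> c) = (a \<oplus> b) [^] (m + l) \<otimes> c"
      using ab c s by (simp add: Suc.hyps(2)[symmetric] m_assoc l_distr r_distr)
    finally show ?thesis .
  qed
qed

lemma (in cring) ideal_radical_ideal:
  assumes I: "ideal I R"
  shows "ideal (ideal_radical R I) R"
proof -
  interpret I: ideal I R by (rule I)
  have mult: "r \<otimes> a \<in> ideal_radical R I" if "a \<in> ideal_radical R I" "r \<in> carrier R" for a r
    using that I.I_l_closed by (fastforce simp: ideal_radical_def nat_pow_distrib)
  have sub: "ideal_radical R I \<subseteq> carrier R" by (auto simp: ideal_radical_def)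
  show ?thesis
  proof (rule idealI)
    show "subgroup (ideal_radical R I) (add_monoid R)"
    proof (rule add.subgroupI)
      have "\<zero> [^] (1::nat) \<in> I" by simp
      then show "ideal_radical R I \<noteq> {}" unfolding ideal_radical_def by blast
      fix a assume a: "a \<in> ideal_radical R I"
      \<comment> \<open>Negation is multiplication by a ring element, so closure under it is an
        instance of \<open>mult\<close>.\<close>
      then have "\<ominus> a = (\<ominus> \<one>) \<otimes> a" using sub by (auto simp: l_minus)
      then show "\<ominus> a \<in> ideal_radical R I" using mult a by simp
      fix b assume "b \<in> ideal_radical R I"
      then obtain m l :: nat where *: "m \<ge> 1" "a [^] m \<in> I" "b [^] l \<in> I"
        and ab: "a \<in> carrier R" "b \<in> carrier R"
        using a by (auto simp: ideal_radical_def)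
      \<comment> \<open>Here the auxiliary factor is \<open>c = \<one>\<close>. The exponent
        \<open>m + l\<close> is at least 1 because \<open>m\<close> is.\<close>
      have "(a \<oplus> b) [^] (m + l) \<otimes> \<one> \<in> I"
        by (rule add_pow_mult_mem_ideal) (use * ab I in auto)
      then show "a \<oplus> b \<in> ideal_radical R I"
        using * ab by (auto simp: ideal_radical_def intro!: exI[of _ "m + l"])
    qed (rule sub)
    show "r \<otimes> a \<in> ideal_radical R I" if "a \<in> ideal_radical R I" "r \<in> carrier R" for a r
      using that by (rule mult)
    then show "a \<otimes> r \<in> ideal_radical R I" if "a \<in> ideal_radical R I" "r \<in> carrier R" for a r
      using that sub m_comm by (metis subsetD)
  qed (rule ring_axioms)
qed

text \<open>If a power of \<open>a \<otimes> b\<close> lies in \<open>Q\<close>, commutativity turns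
  it into a product of powers of \<open>a\<close> and \<open>b\<close> with the same exponent
  \<open>m\<close>. The primary condition applied to these two powers puts in \<open>Q\<close>
  either the power of \<open>a\<close> or a further power of the power of \<open>b\<close>.\<close>

lemma (in cring) primary_ideal_radical_prime:
  assumes Q: "primary_ideal R Q"
  shows "primeideal (ideal_radical R Q) R"
proof (rule primeidealI)
  have I: "ideal Q R" using Q by (simp add: primary_ideal_def)
  interpret Q: ideal Q R by (rule I)
  show "ideal (ideal_radical R Q) R" using I by (rule ideal_radical_ideal)
  show "cring R" by (rule is_cring)
  have "\<one> \<notin> Q" using Q Q.one_imp_carrier by (auto simp: primary_ideal_def)
  then have "\<one> \<notin> ideal_radical R Q" by (simp add: ideal_radical_def)
  then show "carrier R \<noteq> ideal_radical R Q" by auto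
  fix a b assume ab: "a \<in> carrier R" "b \<in> carrier R" "a \<otimes> b \<in> ideal_radical R Q"
  then obtain m :: nat where m: "m \<ge> 1" "a [^] m \<otimes> b [^] m \<in> Q"
    by (auto simp: ideal_radical_def nat_pow_distrib)
  then consider "a [^] m \<in> Q" | l :: nat where "l \<ge> 1" "(b [^] m) [^] l \<in> Q"
    using Q ab by (auto simp: primary_ideal_def)
  then show "a \<in> ideal_radical R Q \<or> b \<in> ideal_radical R Q"
  proof cases
    case 1
    then show ?thesis using ab m by (auto simp: ideal_radical_def)
  next
    case 2
    then have "b [^] (m * l) \<in> Q" "m * l \<ge> 1" using ab m by (auto simp: nat_pow_pow)
    then show ?thesis using ab by (auto simp: ideal_radical_def)
  qed
qed

lemma ideal_radical_mono: "I \<subseteq> J \<Longrightarrow> ideal_radical R I \<subseteq> ideal_radical R J"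
  by (auto simp: ideal_radical_def)

lemma (in cring) ideal_radical_idem:
  "ideal_radical R (ideal_radical R I) = ideal_radical R I" (is "?l = ?r")
proof
  show "?l \<subseteq> ?r"
  proof
    fix a assume "a \<in> ?l"
    then obtain m l :: nat where "a \<in> carrier R" "m \<ge> 1" "l \<ge> 1" "(a [^] m) [^] l \<in> I"
      by (auto simp: ideal_radical_def)
    then show "a \<in> ?r"
      by (auto simp: ideal_radical_def nat_pow_pow intro!: exI[of _ "m * l"])
  qed
  show "?r \<subseteq> ?l"
  proof
    fix a assume a: "a \<in> ?r"
    then have "a [^] (1::nat) \<in> ?r" by (auto simp: ideal_radical_def)
    with a show "a \<in> ?l" unfolding ideal_radical_def by blast
  qed
qed

lemma (in primeideal) ideal_radical_eq: "ideal_radical R I = I"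
proof
  have "a \<in> I" if "a \<in> carrier R" "a [^] m \<in> I" for a and m :: nat
    using that(2)
  proof (induction m)
    case 0
    then show ?case using I_notcarr one_imp_carrier by auto
  next
    case (Suc m)
    then show ?case using I_prime that(1) by auto
  qed
  then show "ideal_radical R I \<subseteq> I" by (auto simp: ideal_radical_def)
  show "I \<subseteq> ideal_radical R I"
  proof
    fix a assume a: "a \<in> I"
    then have "a \<in> carrier R" "a [^] (1::nat) \<in> I" using Icarr by auto
    then show "a \<in> ideal_radical R I" unfolding ideal_radical_def by blast
  qed
qed

text \<open>If no \<open>J j\<close> were inside \<open>I\<close>, one could pick an element outside
  \<open>I\<close> from each; their product lies in every \<open>J j\<close>, yet not in the prime
  \<open>I\<close>. The factor \<open>carrier R\<close> matters for empty \<open>A\<close>, where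
  the bare intersection is the whole type; the inclusion then contradicts properness of
  \<open>I\<close>.\<close>

lemma (in primeideal) ideal_subset_if_INT_subset:
  assumes "finite A" "\<And>j. j \<in> A \<Longrightarrow> ideal (J j) R" "carrier R \<inter> (\<Inter>j\<in>A. J j) \<subseteq> I"
  shows "\<exists>j\<in>A. J j \<subseteq> I"
proof (rule ccontr)
  assume "\<not> ?thesis"
  then have "\<exists>a. a \<in> J j \<and> a \<notin> I" if "j \<in> A" for j using that by blast
  \<comment> \<open>The induction builds the product of the chosen elements, starting from the empty
    product \<open>\<one>\<close>.\<close>
  with assms(1,2) have "\<exists>a\<in>carrier R. a \<notin> I \<and> (\<forall>j\<in>A. a \<in> J j)"
  proof (induction A rule: finite_induct)
    case empty
    have "\<one> \<notin> I" using I_notcarr one_imp_carrier by metis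
    then show ?case by blast
  next
    case (insert i A)
    then have "\<exists>a\<in>carrier R. a \<notin> I \<and> (\<forall>j\<in>A. a \<in> J j)" by simp
    then obtain a where a: "a \<in> carrier R" "a \<notin> I" "\<And>j. j \<in> A \<Longrightarrow> a \<in> J j" by blast
    obtain b where b: "b \<in> J i" "b \<notin> I" using insert.prems(2) by blast
    have id: "ideal (J j) R" if "j \<in> insert i A" for j using insert.prems(1) that .
    have bc: "b \<in> carrier R" by (rule ideal.Icarr[OF id[OF insertI1] b(1)])
    have "a \<otimes> b \<notin> I" using a b bc I_prime by blast
    moreover have "a \<otimes> b \<in> J i" using id b a by (simp add: ideal.I_l_closed)
    moreover have "a \<otimes> b \<in> J j" if "j \<in> A" for j
      using id[of j] that a bc by (simp add: ideal.I_r_closed)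
    ultimately show ?case using a bc by blast
  qed
  then show False using assms(3) by blast
qed

section \<open>Monotonicity of the operations of an le-module\<close>

context le_module
begin

lemma add_closed:
  assumes "a \<in> carrier M" "b \<in> carrier M"
  shows "a \<boxplus>\<^bsub>M\<^esub> b \<in> carrier M"
proof -
  interpret comm_monoid "le_semigroup_monoid M" by (rule add_comm_monoid)
  show ?thesis using m_closed assms by (simp add: le_semigroup_monoid_def)
qed

lemma add_commute:
  assumes "a \<in> carrier M" "b \<in> carrier M"
  shows "a \<boxplus>\<^bsub>M\<^esub> b = b \<boxplus>\<^bsub>M\<^esub> a"
proof -
  interpret comm_monoid "le_semigroup_monoid M" by (rule add_comm_monoid)
  show ?thesis using m_comm assms by (simp add: le_semigroup_monoid_def)
qed

text \<open>The axioms give distributivity over joins but do not state monotonicity. Encoding an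
  inequality as an equation for a two-element join lets the distributive laws yield monotonicity of
  addition and of scalar multiplication.\<close>

lemma sup_pair_eq:
  assumes "a \<in> carrier M" "b \<in> carrier M" "a \<sqsubseteq>\<^bsub>M\<^esub> b"
  shows "\<Squnion>\<^bsub>M\<^esub>{a, b} = b"
proof (rule le_antisym)
  show "\<Squnion>\<^bsub>M\<^esub>{a, b} \<sqsubseteq>\<^bsub>M\<^esub> b" by (rule sup_least) (use assms in auto)
  show "b \<sqsubseteq>\<^bsub>M\<^esub> \<Squnion>\<^bsub>M\<^esub>{a, b}" by (rule sup_upper) (use assms in auto)
qed (use assms in auto)

lemma add_left_mono:
  assumes "a \<in> carrier M" "b \<in> carrier M" "c \<in> carrier M" "a \<sqsubseteq>\<^bsub>M\<^esub> b"
  shows "c \<boxplus>\<^bsub>M\<^esub> a \<sqsubseteq>\<^bsub>M\<^esub> c \<boxplus>\<^bsub>M\<^esub> b"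
proof -
  have "c \<boxplus>\<^bsub>M\<^esub> b = \<Squnion>\<^bsub>M\<^esub>{c \<boxplus>\<^bsub>M\<^esub> a, c \<boxplus>\<^bsub>M\<^esub> b}"
    using add_sup_distrib[of c "{a, b}"] assms by (simp add: sup_pair_eq)
  moreover have "c \<boxplus>\<^bsub>M\<^esub> a \<sqsubseteq>\<^bsub>M\<^esub> \<Squnion>\<^bsub>M\<^esub>{c \<boxplus>\<^bsub>M\<^esub> a, c \<boxplus>\<^bsub>M\<^esub> b}"
    by (rule sup_upper) (use assms add_closed in auto)
  ultimately show ?thesis by simp
qed

lemma add_mono_le:
  assumes "a \<in> carrier M" "b \<in> carrier M" "c \<in> carrier M" "d \<in> carrier M"
    and "a \<sqsubseteq>\<^bsub>M\<^esub> b" "c \<sqsubseteq>\<^bsub>M\<^esub> d"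
  shows "a \<boxplus>\<^bsub>M\<^esub> c \<sqsubseteq>\<^bsub>M\<^esub> b \<boxplus>\<^bsub>M\<^esub> d"
proof -
  have "c \<boxplus>\<^bsub>M\<^esub> a \<sqsubseteq>\<^bsub>M\<^esub> c \<boxplus>\<^bsub>M\<^esub> b" "b \<boxplus>\<^bsub>M\<^esub> c \<sqsubseteq>\<^bsub>M\<^esub> b \<boxplus>\<^bsub>M\<^esub> d"
    using assms by (auto intro: add_left_mono)
  then show ?thesis using assms add_closed add_commute by (metis le_trans)
qed

lemma smult_mono:
  assumes "a \<in> carrier M" "b \<in> carrier M" "r \<in> carrier R" "a \<sqsubseteq>\<^bsub>M\<^esub> b"
  shows "r \<cdot>\<^bsub>M\<^esub> a \<sqsubseteq>\<^bsub>M\<^esub> r \<cdot>\<^bsub>M\<^esub> b"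
proof -
  have "r \<cdot>\<^bsub>M\<^esub> b = \<Squnion>\<^bsub>M\<^esub>{r \<cdot>\<^bsub>M\<^esub> a, r \<cdot>\<^bsub>M\<^esub> b}"
    using smult_sup_distrib[of r "{a, b}"] assms by (simp add: sup_pair_eq)
  moreover have "r \<cdot>\<^bsub>M\<^esub> a \<sqsubseteq>\<^bsub>M\<^esub> \<Squnion>\<^bsub>M\<^esub>{r \<cdot>\<^bsub>M\<^esub> a, r \<cdot>\<^bsub>M\<^esub> b}"
    by (rule sup_upper) (use assms smult_closed in auto)
  ultimately show ?thesis by simp
qed

section \<open>Colon ideals of submodule elements and of primary elements\<close>

text \<open>For sums, the one-sided law \<open>add_smult_le\<close> suffices:
  \<open>(a + b)x \<le> ax + bx \<le> l + l \<le> l\<close>. As \<open>M\<close> has no negatives,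
  closure under negation is obtained in \<open>R\<close>, by multiplying with the negative of
  \<open>\<one>\<close>.\<close>

lemma colon_ideal:
  assumes l: "submodule_element R M l" and x: "x \<in> carrier M"
  shows "ideal (colon R M l x) R"
proof -
  have lc: "l \<in> carrier M" and ll: "l \<boxplus>\<^bsub>M\<^esub> l \<sqsubseteq>\<^bsub>M\<^esub> l"
    and rl: "\<And>r. r \<in> carrier R \<Longrightarrow> r \<cdot>\<^bsub>M\<^esub> l \<sqsubseteq>\<^bsub>M\<^esub> l"
    using l by (auto simp: submodule_element_def)
  have mult: "r \<otimes>\<^bsub>R\<^esub> a \<in> colon R M l x" if "a \<in> colon R M l x" "r \<in> carrier R" for a r
  proof -
    have "r \<cdot>\<^bsub>M\<^esub> (a \<cdot>\<^bsub>M\<^esub> x) \<sqsubseteq>\<^bsub>M\<^esub> r \<cdot>\<^bsub>M\<^esub> l"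
      using that x lc smult_closed by (auto simp: colon_def intro: smult_mono)
    then have "r \<cdot>\<^bsub>M\<^esub> (a \<cdot>\<^bsub>M\<^esub> x) \<sqsubseteq>\<^bsub>M\<^esub> l"
      by (rule le_trans) (use that x lc smult_closed rl in \<open>auto simp: colon_def\<close>)
    then show ?thesis using that x by (auto simp: colon_def mult_smult)
  qed
  show ?thesis
  proof (rule idealI)
    show "ring R" by (rule R.ring_axioms)
    show "subgroup (colon R M l x) (add_monoid R)"
    proof (rule R.add.subgroupI)
      show "colon R M l x \<subseteq> carrier R" by (auto simp: colon_def)
      \<comment> \<open>Scaling \<open>l\<close> by zero shows that a submodule element lies above
        the zero of \<open>M\<close>, which need not be the least element of the lattice.\<close>
      have "le_zero M \<sqsubseteq>\<^bsub>M\<^esub> l" using rl[of "\<zero>\<^bsub>R\<^esub>"] lc by (simp add: zero_smult)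
      then have "\<zero>\<^bsub>R\<^esub> \<in> colon R M l x" using x by (simp add: colon_def zero_smult)
      then show "colon R M l x \<noteq> {}" by blast
      fix a assume a: "a \<in> colon R M l x"
      then have "\<ominus>\<^bsub>R\<^esub> a = (\<ominus>\<^bsub>R\<^esub> \<one>\<^bsub>R\<^esub>) \<otimes>\<^bsub>R\<^esub> a" by (simp add: colon_def R.l_minus)
      then show "\<ominus>\<^bsub>R\<^esub> a \<in> colon R M l x" using mult a by simp
      fix b assume b: "b \<in> colon R M l x"
      have ab: "a \<in> carrier R" "b \<in> carrier R" "a \<cdot>\<^bsub>M\<^esub> x \<sqsubseteq>\<^bsub>M\<^esub> l" "b \<cdot>\<^bsub>M\<^esub> x \<sqsubseteq>\<^bsub>M\<^esub> l"
        using a b by (auto simp: colon_def)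
      have "a \<cdot>\<^bsub>M\<^esub> x \<boxplus>\<^bsub>M\<^esub> b \<cdot>\<^bsub>M\<^esub> x \<sqsubseteq>\<^bsub>M\<^esub> l \<boxplus>\<^bsub>M\<^esub> l"
        using ab x lc smult_closed by (auto intro: add_mono_le)
      then have "(a \<oplus>\<^bsub>R\<^esub> b) \<cdot>\<^bsub>M\<^esub> x \<sqsubseteq>\<^bsub>M\<^esub> l"
        using add_smult_le[OF ab(1,2) x] ll ab x lc smult_closed add_closed R.add.m_closed
        by (metis le_trans)
      then show "a \<oplus>\<^bsub>R\<^esub> b \<in> colon R M l x" using ab by (simp add: colon_def)
    qed
    show "r \<otimes>\<^bsub>R\<^esub> a \<in> colon R M l x" if "a \<in> colon R M l x" "r \<in> carrier R" for a r
      using that by (rule mult)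
    then show "a \<otimes>\<^bsub>R\<^esub> r \<in> colon R M l x" if "a \<in> colon R M l x" "r \<in> carrier R" for a r
      using that R.m_comm[of a r] by (simp add: colon_def)
  qed
qed

lemma colon_eq_carrier:
  assumes "submodule_element R M l" "x \<in> carrier M" "x \<sqsubseteq>\<^bsub>M\<^esub> l"
  shows "colon R M l x = carrier R"
proof -
  have "\<one>\<^bsub>R\<^esub> \<in> colon R M l x" using assms by (simp add: colon_def one_smult)
  then show ?thesis using colon_ideal[OF assms(1,2)] ideal.one_imp_carrier by blast
qed

text \<open>This turns a meet decomposition of \<open>n\<close> into an intersection of ideals.
  Intersecting with \<open>carrier R\<close> gives the correct value for \<open>A = {}\<close>,
  where the meet is the top element.\<close>

lemma colon_Inf:
  assumes "A \<subseteq> carrier M" "x \<in> carrier M"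
  shows "colon R M (\<Sqinter>\<^bsub>M\<^esub>A) x = carrier R \<inter> (\<Inter>l\<in>A. colon R M l x)"
proof -
  have "r \<cdot>\<^bsub>M\<^esub> x \<sqsubseteq>\<^bsub>M\<^esub> \<Sqinter>\<^bsub>M\<^esub>A \<longleftrightarrow> (\<forall>l\<in>A. r \<cdot>\<^bsub>M\<^esub> x \<sqsubseteq>\<^bsub>M\<^esub> l)" if "r \<in> carrier R" for r
  proof -
    have "r \<cdot>\<^bsub>M\<^esub> x \<in> carrier M" using that assms smult_closed by simp
    then show ?thesis
      using assms inf_lower inf_greatest inf_closed le_trans by (meson subsetD)
  qed
  then show ?thesis by (auto simp: colon_def)
qed

text \<open>If \<open>ab\<close> lies in \<open>(q : x)\<close>, then \<open>b(ax) \<le> q\<close>,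
  and the primary condition on \<open>q\<close> gives \<open>ax \<le> q\<close> or a power of
  \<open>b\<close> in \<open>(q : e)\<close>, which is contained in \<open>(q : x)\<close>. For the
  radical, \<open>(q : e) \<subseteq> (q : x) \<subseteq> Rad q\<close>: the second inclusion is the
  primary condition once more, with \<open>x\<close> not below \<open>q\<close>.\<close>

lemma colon_primary:
  assumes q: "primary_element R M q" and x: "x \<in> carrier M" and xq: "\<not> x \<sqsubseteq>\<^bsub>M\<^esub> q"
  shows "primary_ideal_to R (Rad R M q) (colon R M q x)"
proof -
  have sub: "submodule_element R M q" and qc: "q \<in> carrier M"
    using q by (auto simp: primary_element_def proper_submodule_element_def submodule_element_def)
  have prim: "y \<sqsubseteq>\<^bsub>M\<^esub> q \<or> (\<exists>m::nat. m \<ge> 1 \<and> a [^]\<^bsub>R\<^esub> m \<in> colon R M q \<top>\<^bsub>M\<^esub>)"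
    if "a \<in> carrier R" "y \<in> carrier M" "a \<cdot>\<^bsub>M\<^esub> y \<sqsubseteq>\<^bsub>M\<^esub> q" for a y
    using q that by (auto simp: primary_element_def colon_def)
  have top_x: "colon R M q \<top>\<^bsub>M\<^esub> \<subseteq> colon R M q x"
  proof
    fix r assume "r \<in> colon R M q \<top>\<^bsub>M\<^esub>"
    then have r: "r \<in> carrier R" "r \<cdot>\<^bsub>M\<^esub> \<top>\<^bsub>M\<^esub> \<sqsubseteq>\<^bsub>M\<^esub> q" by (auto simp: colon_def)
    have "r \<cdot>\<^bsub>M\<^esub> x \<sqsubseteq>\<^bsub>M\<^esub> r \<cdot>\<^bsub>M\<^esub> \<top>\<^bsub>M\<^esub>" using r x by (intro smult_mono) auto
    then have "r \<cdot>\<^bsub>M\<^esub> x \<sqsubseteq>\<^bsub>M\<^esub> q" by (rule le_trans) (use r x qc smult_closed in auto)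
    then show "r \<in> colon R M q x" using r by (simp add: colon_def)
  qed
  have "primary_ideal R (colon R M q x)"
    unfolding primary_ideal_def
  proof (intro conjI ballI impI)
    show "ideal (colon R M q x) R" using sub x by (rule colon_ideal)
    have "\<one>\<^bsub>R\<^esub> \<notin> colon R M q x" using xq x by (simp add: colon_def one_smult)
    then show "colon R M q x \<noteq> carrier R" by auto
    fix a b assume ab: "a \<in> carrier R" "b \<in> carrier R" "a \<otimes>\<^bsub>R\<^esub> b \<in> colon R M q x"
    then have "b \<cdot>\<^bsub>M\<^esub> (a \<cdot>\<^bsub>M\<^esub> x) \<sqsubseteq>\<^bsub>M\<^esub> q"
      using x R.m_comm[of a b] by (simp add: colon_def mult_smult)
    then have "a \<cdot>\<^bsub>M\<^esub> x \<sqsubseteq>\<^bsub>M\<^esub> q \<or> (\<exists>m::nat. m \<ge> 1 \<and> b [^]\<^bsub>R\<^esub> m \<in> colon R M q \<top>\<^bsub>M\<^esub>)"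
      using prim ab x smult_closed by blast
    then show "a \<in> colon R M q x \<or> (\<exists>m::nat. m \<ge> 1 \<and> b [^]\<^bsub>R\<^esub> m \<in> colon R M q x)"
    proof
      assume "a \<cdot>\<^bsub>M\<^esub> x \<sqsubseteq>\<^bsub>M\<^esub> q"
      then show ?thesis using ab by (simp add: colon_def)
    next
      assume "\<exists>m::nat. m \<ge> 1 \<and> b [^]\<^bsub>R\<^esub> m \<in> colon R M q \<top>\<^bsub>M\<^esub>"
      then show ?thesis using top_x by blast
    qed
  qed
  moreover have "colon R M q x \<subseteq> Rad R M q"
  proof
    fix a assume "a \<in> colon R M q x"
    then have a: "a \<in> carrier R" "a \<cdot>\<^bsub>M\<^esub> x \<sqsubseteq>\<^bsub>M\<^esub> q" by (auto simp: colon_def)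
    then show "a \<in> Rad R M q"
      using prim[OF a(1) x a(2)] xq unfolding Rad_def ideal_radical_def by blast
  qed
  \<comment> \<open>Taking radicals in the chain
    \<open>(q : e) \<subseteq> (q : x) \<subseteq> Rad q\<close> squeezes the middle one, because
    the radical of \<open>Rad q\<close> is \<open>Rad q\<close> again.\<close>
  from ideal_radical_mono[OF this, of R] have "ideal_radical R (colon R M q x) \<subseteq> Rad R M q"
    by (simp add: Rad_def R.ideal_radical_idem)
  then have "ideal_radical R (colon R M q x) = Rad R M q"
    using ideal_radical_mono[OF top_x, of R] by (simp add: Rad_def)
  ultimately show ?thesis by (simp add: primary_ideal_to_def)
qed

text \<open>Take \<open>x\<close> to be the top element in \<open>colon_primary\<close>; it is not
  below \<open>q\<close> because \<open>q\<close> is proper.\<close>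

lemma Rad_primary_prime:
  assumes q: "primary_element R M q"
  shows "primeideal (Rad R M q) R"
proof -
  have "q \<in> carrier M" "q \<noteq> \<top>\<^bsub>M\<^esub>"
    using q by (auto simp: primary_element_def proper_submodule_element_def submodule_element_def)
  then have "\<not> \<top>\<^bsub>M\<^esub> \<sqsubseteq>\<^bsub>M\<^esub> q" using le_antisym[of q "\<top>\<^bsub>M\<^esub>"] by auto
  from colon_primary[OF q top_closed this] show ?thesis
    using R.primary_ideal_radical_prime[of "colon R M q \<top>\<^bsub>M\<^esub>"]
    by (simp add: primary_ideal_to_def)
qed

section \<open>Associated primes and their independence of the decomposition\<close>

lemma primary_decomposition_carrier:
  assumes "primary_decomposition R M n k q"
  shows "q ` {1..k} \<subseteq> carrier M"
  using assms by (auto simp: primary_decomposition_def primary_element_def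
      proper_submodule_element_def submodule_element_def)

lemma associated_prime_is_colon_radical:
  assumes red: "reduced_primary_decomposition R M n k q" and i: "i \<in> {1..k}"
  shows "\<exists>x\<in>carrier M. \<not> x \<sqsubseteq>\<^bsub>M\<^esub> n \<and> primary_ideal_to R (Rad R M (q i)) (colon R M n x)"
proof -
  have dec: "primary_decomposition R M n k q"
    using red by (simp add: reduced_primary_decomposition_def)
  then have n: "n = \<Sqinter>\<^bsub>M\<^esub>(q ` {1..k})" and prim: "\<And>j. j \<in> {1..k} \<Longrightarrow> primary_element R M (q j)"
    by (auto simp: primary_decomposition_def)
  note qc = primary_decomposition_carrier[OF dec]
  \<comment> \<open>Irredundancy of the decomposition says precisely that this \<open>x\<close> is
    not below \<open>q i\<close>. For \<open>k = 1\<close> the meet is empty and \<open>x\<close> is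
    the top element.\<close>
  define x where "x = \<Sqinter>\<^bsub>M\<^esub>(q ` ({1..k} - {i}))"
  have x: "x \<in> carrier M" unfolding x_def by (rule inf_closed) (use qc in auto)
  have xi: "\<not> x \<sqsubseteq>\<^bsub>M\<^esub> q i"
    using red i by (auto simp: reduced_primary_decomposition_def x_def)
  have nc: "n \<in> carrier M" unfolding n by (rule inf_closed) (use qc in auto)
  have "n \<sqsubseteq>\<^bsub>M\<^esub> q i" unfolding n by (rule inf_lower) (use qc i in auto)
  then have xn: "\<not> x \<sqsubseteq>\<^bsub>M\<^esub> n" using xi x nc qc i le_trans[of x n "q i"] by blast
  \<comment> \<open>These components contribute the whole ring to the intersection, so only
    \<open>(q i : x)\<close> survives.\<close>
  have "colon R M (q j) x = carrier R" if "j \<in> {1..k} - {i}" for j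
  proof (rule colon_eq_carrier)
    show "submodule_element R M (q j)"
      using prim that by (auto simp: primary_element_def proper_submodule_element_def)
    show "x \<sqsubseteq>\<^bsub>M\<^esub> q j" unfolding x_def by (rule inf_lower) (use qc that in auto)
  qed (rule x)
  moreover have "colon R M (q i) x \<subseteq> carrier R" by (auto simp: colon_def)
  ultimately have "carrier R \<inter> (\<Inter>j\<in>{1..k}. colon R M (q j) x) = colon R M (q i) x"
    using i by blast
  then have "colon R M n x = colon R M (q i) x"
    unfolding n using colon_Inf[OF qc x] by simp
  then show ?thesis using colon_primary[OF prim[OF i] x xi] x xn by auto
qed

lemma colon_radical_is_associated_prime:
  assumes dec: "primary_decomposition R M n k q" and P: "primeideal P R"
    and x: "x \<in> carrier M" and nx: "primary_ideal_to R P (colon R M n x)"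
  shows "\<exists>i\<in>{1..k}. P = Rad R M (q i)"
proof -
  interpret P: primeideal P R by (rule P)
  have n: "n = \<Sqinter>\<^bsub>M\<^esub>(q ` {1..k})" and prim: "\<And>j. j \<in> {1..k} \<Longrightarrow> primary_element R M (q j)"
    using dec by (auto simp: primary_decomposition_def)
  have sub: "submodule_element R M (q j)" if "j \<in> {1..k}" for j
    using prim[OF that] by (auto simp: primary_element_def proper_submodule_element_def)
  have colon_n: "colon R M n x = carrier R \<inter> (\<Inter>j\<in>{1..k}. colon R M (q j) x)"
    unfolding n using colon_Inf[OF primary_decomposition_carrier[OF dec] x] by simp
  have radP: "ideal_radical R (colon R M n x) = P"
    using nx by (simp add: primary_ideal_to_def)
  have "colon R M n x \<subseteq> P"
  proof
    fix a assume a: "a \<in> colon R M n x"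
    then have "a \<in> carrier R" "a [^]\<^bsub>R\<^esub> (1::nat) \<in> colon R M n x" by (auto simp: colon_def)
    then show "a \<in> P" unfolding radP[symmetric] ideal_radical_def by blast
  qed
  then obtain i where i: "i \<in> {1..k}" "colon R M (q i) x \<subseteq> P"
    using P.ideal_subset_if_INT_subset[of "{1..k}" "\<lambda>j. colon R M (q j) x"] colon_n
      colon_ideal[OF sub x] by auto
  \<comment> \<open>Otherwise \<open>(q i : x)\<close> would be all of \<open>R\<close>, which does
    not fit into the proper ideal \<open>P\<close>.\<close>
  have "\<not> x \<sqsubseteq>\<^bsub>M\<^esub> q i"
    using colon_eq_carrier[OF sub[OF i(1)] x] i P.I_notcarr P.a_subset by blast
  then have "ideal_radical R (colon R M (q i) x) = Rad R M (q i)"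
    using colon_primary[OF prim[OF i(1)] x] by (simp add: primary_ideal_to_def)
  moreover have "ideal_radical R (colon R M (q i) x) \<subseteq> P"
    using ideal_radical_mono[OF i(2), of R] P.ideal_radical_eq by simp
  \<comment> \<open>The other inclusion comes from \<open>(n : x) \<subseteq> (q i : x)\<close>,
    since \<open>P\<close> is the radical of the smaller ideal.\<close>
  moreover have "P \<subseteq> ideal_radical R (colon R M (q i) x)"
    unfolding radP[symmetric] by (rule ideal_radical_mono) (use colon_n i in auto)
  ultimately show ?thesis using i(1) by auto
qed

lemma associated_primes_iff:
  assumes red: "reduced_primary_decomposition R M n k q" and P: "primeideal P R"
  shows "(\<exists>i\<in>{1..k}. P = Rad R M (q i)) \<longleftrightarrow>
    (\<exists>x\<in>carrier M. \<not> x \<sqsubseteq>\<^bsub>M\<^esub> n \<and> primary_ideal_to R P (colon R M n x))"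
proof
  assume "\<exists>i\<in>{1..k}. P = Rad R M (q i)"
  then show "\<exists>x\<in>carrier M. \<not> x \<sqsubseteq>\<^bsub>M\<^esub> n \<and> primary_ideal_to R P (colon R M n x)"
    using associated_prime_is_colon_radical[OF red] by blast
next
  have "primary_decomposition R M n k q"
    using red by (simp add: reduced_primary_decomposition_def)
  note * = colon_radical_is_associated_prime[OF this P]
  assume "\<exists>x\<in>carrier M. \<not> x \<sqsubseteq>\<^bsub>M\<^esub> n \<and> primary_ideal_to R P (colon R M n x)"
  then show "\<exists>i\<in>{1..k}. P = Rad R M (q i)" by (elim bexE conjE) (rule *)
qed

text \<open>A single inclusion is enough: exchanging the two decompositions gives the reverse
  one.\<close>

lemma associated_primes_subset:
  assumes "reduced_primary_decomposition R M n k q" "reduced_primary_decomposition R M n k' q'"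
  shows "(\<lambda>i. Rad R M (q i)) ` {1..k} \<subseteq> (\<lambda>i. Rad R M (q' i)) ` {1..k'}"
proof
  fix P assume "P \<in> (\<lambda>i. Rad R M (q i)) ` {1..k}"
  then obtain i where i: "i \<in> {1..k}" "P = Rad R M (q i)" by blast
  have "primary_element R M (q i)"
    using assms(1) i(1) by (simp add: reduced_primary_decomposition_def primary_decomposition_def)
  then have "primeideal P R" unfolding i(2) by (rule Rad_primary_prime)
  then have "\<exists>i\<in>{1..k'}. P = Rad R M (q' i)"
    using associated_primes_iff[OF assms(2)] associated_prime_is_colon_radical[OF assms(1) i(1)] i(2)
    by simp
  then show "P \<in> (\<lambda>i. Rad R M (q' i)) ` {1..k'}" by blast
qed

end

theorem theorem4p4:
  fixes R :: "('r, 'x) ring_scheme" and M :: "('r, 'm, 'z) le_module_scheme"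
    and n :: 'm and k :: nat and q :: "nat \<Rightarrow> 'm"
  assumes "le_module R M"
    and "laskerian R M"
    and "submodule_element R M n"
    and "reduced_primary_decomposition R M n k q"
  shows "(\<forall>P. primeideal P R \<longrightarrow>
            ((\<exists>i \<in> {1..k}. P = Rad R M (q i)) \<longleftrightarrow>
             (\<exists>x \<in> carrier M. \<not> x \<sqsubseteq>\<^bsub>M\<^esub> n \<and> primary_ideal_to R P (colon R M n x))))
       \<and> (\<forall>k' q'. reduced_primary_decomposition R M n k' q' \<longrightarrow>
            (\<lambda>i. Rad R M (q' i)) ` {1..k'} = (\<lambda>i. Rad R M (q i)) ` {1..k})"
proof -
  interpret le_module R M by (rule assms(1))
  show ?thesis
  proof (intro conjI allI impI)
    fix P assume "primeideal P R"
    then show "(\<exists>i\<in>{1..k}. P = Rad R M (q i)) \<longleftrightarrow>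
        (\<exists>x\<in>carrier M. \<not> x \<sqsubseteq>\<^bsub>M\<^esub> n \<and> primary_ideal_to R P (colon R M n x))"
      by (rule associated_primes_iff[OF assms(4)])
  next
    fix k' q' assume "reduced_primary_decomposition R M n k' q'"
    then show "(\<lambda>i. Rad R M (q' i)) ` {1..k'} = (\<lambda>i. Rad R M (q i)) ` {1..k}"
      using assms(4) by (intro subset_antisym associated_primes_subset)
  qed
qed

end
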